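(* Let $F$ be a field and let $A_1,\dots,A_n$ be finite non-empty zero-sum subsets of $F$ (i.e. $\sum_{a\in A_i} a=0$ for each $i$). Assume that a polynomial $f\in F[X_1,\dots,X_n]$ contains a monomial $X_1^{k_1}\cdots X_n^{k_n}$ with non-zero coefficient, such that $k_1<|A_1|,\dots,k_n<|A_n|$ and \[\deg(f)\leq k_1+\dots+k_n+1.\] Then $f(a)\neq 0$ for some grid point $a\in A_1\times\dots\times A_n$.
   Context: $\deg(f)$ denotes the total degree of $f$. *)

theory Defs
  imports Main "HOL-Library.Poly_Mapping" "HOL-Library.FuncSet"
begin

text \<open>A monomial is a finitely supported exponent vector, a polynomial a finitely supported
  family of coefficients. The multiplication of \<^typ>\<open>(nat \<Rightarrow>\<^sub>0 nat) \<Rightarrow>\<^sub>0 'a::field\<close>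
  from the library is the convolution product, so this is the polynomial ring over \<open>'a\<close> in
  the variables \<open>X\<^sub>i\<close> for all \<open>i :: nat\<close>; the ring in \<open>X\<^sub>1, \<dots>, X\<^sub>n\<close> consists of the
  polynomials whose variables (see \<open>vars\<close>) lie in \<open>{1..n}\<close>.\<close>

type_synonym 'a mpoly = "(nat \<Rightarrow>\<^sub>0 nat) \<Rightarrow>\<^sub>0 'a"

definition vars :: "'a::zero mpoly \<Rightarrow> nat set" where
  "vars f = (\<Union>m\<in>Poly_Mapping.keys f. Poly_Mapping.keys m)"

definition monom_degree :: "(nat \<Rightarrow>\<^sub>0 nat) \<Rightarrow> nat" where
  "monom_degree m = (\<Sum>i\<in>Poly_Mapping.keys m. Poly_Mapping.lookup m i)"

text \<open>The zero polynomial gets total degree 0.\<close>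

definition total_degree :: "'a::zero mpoly \<Rightarrow> nat" where
  "total_degree f = Max (insert 0 (monom_degree ` Poly_Mapping.keys f))"

definition eval_mpoly :: "'a::comm_semiring_1 mpoly \<Rightarrow> (nat \<Rightarrow> 'a) \<Rightarrow> 'a" where
  "eval_mpoly f x = (\<Sum>m\<in>Poly_Mapping.keys f.
    Poly_Mapping.lookup f m * (\<Prod>i\<in>Poly_Mapping.keys m. x i ^ Poly_Mapping.lookup m i))"

end

theory Submission
  imports Defs
begin

text \<open>The functional \<open>g \<mapsto> \<Sum>\<^sub>a g(a) / \<Prod>\<^sub>b (a - b)\<close>, with \<open>b\<close> ranging over \<open>A - {a}\<close>, maps the powers
  of degree \<open>card A - 1\<close> and \<open>card A\<close> to \<open>1\<close> and \<open>\<Sum>A\<close>, and all lower powers to \<open>0\<close>. Precomposed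
  with multiplication by \<open>X\<close> to the power \<open>card A - 1 - k\<close>, it reads off the coefficient of
  degree \<open>k\<close> from a polynomial of order at least \<open>k\<close> and degree at most \<open>k + 1\<close>,
  because \<open>\<Sum>A = 0\<close>. In the tensor product of these functionals over the variables, a monomial
  of \<open>f\<close> survives only if it is divisible by the given one; by the degree bound it is then the given
  one itself or the given one times a single variable, and the latter is killed. So a weighted sum of
  the values of \<open>f\<close> on the grid equals the given coefficient.\<close>

text \<open>Induction on \<open>A\<close> follows the recursion for divided differences: adjoining a
  node \<open>c\<close> replaces a functional L by g \<mapsto> L((g - g(c)) / (X - c)), which raises
  by one the degree below which powers are killed.\<close>

lemma divided_difference_weights:
  fixes A :: "'a::field set"
  assumes "finite A" "A \<noteq> {}"
  shows "\<exists>w. (\<forall>m < card A - 1. (\<Sum>a\<in>A. w a * a ^ m) = 0) \<and>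
    (\<Sum>a\<in>A. w a * a ^ (card A - 1)) = 1 \<and> (\<Sum>a\<in>A. w a * a ^ card A) = \<Sum>A"
  using assms
proof (induction A rule: finite_ne_induct)
  case (singleton c)
  show ?case by (intro exI[of _ "\<lambda>_. 1"]) simp
next
  case (insert c A)
  define d where "d = card A - 1"
  have card: "card A = Suc d" "card (insert c A) = Suc (Suc d)"
    using insert.hyps by (auto simp: d_def card_gt_0_iff)
  obtain w where w0: "\<And>m. m < d \<Longrightarrow> (\<Sum>a\<in>A. w a * a ^ m) = 0"
    and w1: "(\<Sum>a\<in>A. w a * a ^ d) = 1" and w2: "(\<Sum>a\<in>A. w a * a ^ Suc d) = \<Sum>A"
    using insert.IH by (auto simp: card)
  \<comment> \<open>The weight at \<open>c\<close> collects the terms - g(c) / (a - c) of the new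
    functional.\<close>
  define v where "v a = (if a = c then - (\<Sum>a\<in>A. w a / (a - c)) else w a / (a - c))" for a
  have v: "(\<Sum>a\<in>insert c A. v a * a ^ m)
      = (\<Sum>j<m. c ^ (m - Suc j) * (\<Sum>a\<in>A. w a * a ^ j))" for m
  proof -
    have "(\<Sum>a\<in>insert c A. v a * a ^ m) = v c * c ^ m + (\<Sum>a\<in>A. v a * a ^ m)"
      using insert.hyps by simp
    also have "(\<Sum>a\<in>A. v a * a ^ m) = (\<Sum>a\<in>A. w a / (a - c) * a ^ m)"
      using insert.hyps by (intro sum.cong) (auto simp: v_def)
    also have "v c * c ^ m + \<dots> = (\<Sum>a\<in>A. w a / (a - c) * (a ^ m - c ^ m))"
      by (simp add: v_def sum_distrib_right right_diff_distrib sum_subtractf)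
    \<comment> \<open>Expanding (a^m - c^m) / (a - c) as a geometric sum leaves only moments of
      \<open>w\<close> of order below \<open>m\<close>.\<close>
    also have "\<dots> = (\<Sum>a\<in>A. \<Sum>j<m. c ^ (m - Suc j) * (w a * a ^ j))"
    proof (intro sum.cong refl)
      fix a assume "a \<in> A"
      then have "a - c \<noteq> 0" using insert.hyps by auto
      then show "w a / (a - c) * (a ^ m - c ^ m) = (\<Sum>j<m. c ^ (m - Suc j) * (w a * a ^ j))"
        by (simp add: power_diff_sumr2 sum_distrib_left mult_ac)
    qed
    also have "\<dots> = (\<Sum>j<m. c ^ (m - Suc j) * (\<Sum>a\<in>A. w a * a ^ j))"
      by (subst sum.swap) (simp add: sum_distrib_left)
    finally show ?thesis .
  qed
  have "(\<Sum>a\<in>insert c A. v a * a ^ m) = 0" if "m < Suc d" for m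
    unfolding v using that by (intro sum.neutral) (simp add: w0)
  moreover have "(\<Sum>a\<in>insert c A. v a * a ^ Suc d) = 1"
    unfolding v by (simp add: w0 w1)
  \<comment> \<open>Only two terms survive: \<open>j = d\<close> gives \<open>c\<close> and
    \<open>j = Suc d\<close> gives \<open>\<Sum>A\<close>.\<close>
  moreover have "(\<Sum>a\<in>insert c A. v a * a ^ Suc (Suc d)) = \<Sum>(insert c A)"
    unfolding v using insert.hyps by (simp add: w0 w1 w2[simplified])
  ultimately show ?case
    unfolding card by (intro exI[of _ v]) simp
qed

lemma zero_sum_weights:
  fixes A :: "'a::field set"
  assumes "finite A" "\<Sum>A = 0" "k < card A"
  shows "\<exists>w. \<forall>m \<le> Suc k. (\<Sum>a\<in>A. w a * a ^ m) = (if m = k then 1 else 0)"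
proof -
  \<comment> \<open>Since \<open>k < card A\<close>, the subtraction does not truncate: adding
    \<open>r\<close> moves \<open>k\<close> and \<open>Suc k\<close> exactly to
    \<open>card A - 1\<close> and \<open>card A\<close>.\<close>
  define r where "r = card A - 1 - k"
  have "A \<noteq> {}" using assms by auto
  with assms obtain w where w0: "\<And>m. m < card A - 1 \<Longrightarrow> (\<Sum>a\<in>A. w a * a ^ m) = 0"
    and w1: "(\<Sum>a\<in>A. w a * a ^ (card A - 1)) = 1" and w2: "(\<Sum>a\<in>A. w a * a ^ card A) = 0"
    using divided_difference_weights[of A] by auto
  have "(\<Sum>a\<in>A. w a * a ^ (r + m)) = (if m = k then 1 else 0)" if "m \<le> Suc k" for m
  proof -
    consider "m < k" | "m = k" | "m = Suc k" using \<open>m \<le> Suc k\<close> by linarith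
    then show ?thesis
    proof cases
      case 1
      then have "r + m < card A - 1" using assms by (simp add: r_def)
      with 1 show ?thesis by (simp add: w0)
    next
      case 2
      then have "r + m = card A - 1" using assms by (simp add: r_def)
      with 2 show ?thesis by (simp add: w1 del: One_nat_def)
    next
      case 3
      then have "r + m = card A" using assms by (simp add: r_def)
      with 3 show ?thesis by (simp add: w2)
    qed
  qed
  then show ?thesis
    by (intro exI[of _ "\<lambda>a. w a * a ^ r"]) (simp add: power_add mult.assoc)
qed

lemma keys_subset_vars: "m \<in> Poly_Mapping.keys f \<Longrightarrow> Poly_Mapping.keys m \<subseteq> vars f"
  by (auto simp: vars_def)

lemma monom_degree_superset:
  assumes "finite I" "Poly_Mapping.keys m \<subseteq> I"
  shows "monom_degree m = (\<Sum>i\<in>I. Poly_Mapping.lookup m i)"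
  unfolding monom_degree_def using assms
  by (intro sum.mono_neutral_left) (auto simp: in_keys_iff)

lemma monom_degree_le_total_degree:
  "m \<in> Poly_Mapping.keys f \<Longrightarrow> monom_degree m \<le> total_degree f"
  unfolding total_degree_def by (intro Max_ge) auto

lemma eval_mpoly_superset:
  assumes "finite I" "vars f \<subseteq> I"
  shows "eval_mpoly f x = (\<Sum>m\<in>Poly_Mapping.keys f.
    Poly_Mapping.lookup f m * (\<Prod>i\<in>I. x i ^ Poly_Mapping.lookup m i))"
  unfolding eval_mpoly_def
proof (intro sum.cong refl arg_cong2[of _ _ _ _ "(*)"] prod.mono_neutral_left)
  fix m assume "m \<in> Poly_Mapping.keys f"
  then show "Poly_Mapping.keys m \<subseteq> I" using assms keys_subset_vars by blast
qed (use assms in \<open>auto simp: in_keys_iff\<close>)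

text \<open>By distributivity, a product weight summed against a monomial over the grid factors into
  one-variable moments.\<close>

lemma sum_weighted_eval_mpoly:
  fixes f :: "'a::comm_semiring_1 mpoly"
  assumes "finite I" "vars f \<subseteq> I" "\<And>i. i \<in> I \<Longrightarrow> finite (A i)"
  shows "(\<Sum>x\<in>Pi\<^sub>E I A. (\<Prod>i\<in>I. w i (x i)) * eval_mpoly f x) =
    (\<Sum>m\<in>Poly_Mapping.keys f. Poly_Mapping.lookup f m *
      (\<Prod>i\<in>I. \<Sum>a\<in>A i. w i a * a ^ Poly_Mapping.lookup m i))"
proof -
  have "(\<Sum>x\<in>Pi\<^sub>E I A. (\<Prod>i\<in>I. w i (x i)) * eval_mpoly f x) =
    (\<Sum>x\<in>Pi\<^sub>E I A. \<Sum>m\<in>Poly_Mapping.keys f. Poly_Mapping.lookup f m *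
      (\<Prod>i\<in>I. w i (x i) * x i ^ Poly_Mapping.lookup m i))"
    by (simp add: eval_mpoly_superset[OF assms(1,2)] sum_distrib_left prod.distrib mult_ac)
  also have "\<dots> = (\<Sum>m\<in>Poly_Mapping.keys f. Poly_Mapping.lookup f m *
      (\<Sum>x\<in>Pi\<^sub>E I A. \<Prod>i\<in>I. w i (x i) * x i ^ Poly_Mapping.lookup m i))"
    by (subst sum.swap) (simp add: sum_distrib_left)
  also have "\<dots> = (\<Sum>m\<in>Poly_Mapping.keys f. Poly_Mapping.lookup f m *
      (\<Prod>i\<in>I. \<Sum>a\<in>A i. w i a * a ^ Poly_Mapping.lookup m i))"
    using assms by (simp add: prod_sum_PiE)
  finally show ?thesis .
qed

theorem theorem1p2:
  fixes n :: nat
    and A :: "nat \<Rightarrow> 'a::field set"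
    and f :: "'a mpoly"
    and k :: "nat \<Rightarrow>\<^sub>0 nat"
  assumes "\<And>i. i \<in> {1..n} \<Longrightarrow> finite (A i)"
    and "\<And>i. i \<in> {1..n} \<Longrightarrow> A i \<noteq> {}"
    and "\<And>i. i \<in> {1..n} \<Longrightarrow> (\<Sum>a\<in>A i. a) = 0"
    and "vars f \<subseteq> {1..n}"
    and "Poly_Mapping.lookup f k \<noteq> 0"
    and "\<And>i. i \<in> {1..n} \<Longrightarrow> Poly_Mapping.lookup k i < card (A i)"
    and "total_degree f \<le> (\<Sum>i=1..n. Poly_Mapping.lookup k i) + 1"
  shows "\<exists>a \<in> (\<Pi>\<^sub>E i\<in>{1..n}. A i). eval_mpoly f a \<noteq> 0"
proof -
  let ?I = "{1..n}"
  let ?e = Poly_Mapping.lookup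
  have "\<exists>w. \<forall>i\<in>?I. \<forall>m \<le> Suc (?e k i). (\<Sum>a\<in>A i. w i a * a ^ m) = (if m = ?e k i then 1 else 0)"
    using zero_sum_weights assms(1,3,6) by (intro bchoice ballI) blast
  then obtain w where w: "\<And>i m. i \<in> ?I \<Longrightarrow> m \<le> Suc (?e k i) \<Longrightarrow>
      (\<Sum>a\<in>A i. w i a * a ^ m) = (if m = ?e k i then 1 else 0)"
    by blast
  have k: "k \<in> Poly_Mapping.keys f" using assms(5) by (simp add: in_keys_iff)
  have off: "(\<Prod>i\<in>?I. \<Sum>a\<in>A i. w i a * a ^ ?e m i) = 0"
    if m: "m \<in> Poly_Mapping.keys f" and "m \<noteq> k" for m
  proof -
    have keys: "Poly_Mapping.keys m \<subseteq> ?I" "Poly_Mapping.keys k \<subseteq> ?I"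
      using m k assms(4) keys_subset_vars by blast+
    have "(\<Sum>i\<in>?I. ?e m i) \<le> (\<Sum>i\<in>?I. ?e k i) + 1"
      using monom_degree_le_total_degree[OF m] assms(7) monom_degree_superset[OF _ keys(1)] by simp
    obtain i0 where i0: "?e m i0 \<noteq> ?e k i0"
      using \<open>m \<noteq> k\<close> poly_mapping_eqI[of m k] by auto
    then have "i0 \<in> ?I" using keys by (metis in_keys_iff subsetD)
    \<comment> \<open>One vanishing factor suffices, but \<open>w\<close> controls moments only up
      to \<open>Suc (?e k i)\<close>, so the exponent must differ from that of \<open>k\<close>
      without exceeding it by more than one.\<close>
    have "\<exists>i\<in>?I. ?e m i \<le> Suc (?e k i) \<and> ?e m i \<noteq> ?e k i"
    proof (cases "\<exists>i\<in>?I. ?e m i < ?e k i")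
      case True
      then show ?thesis by force
    next
      case False
      \<comment> \<open>With no exponent below that of \<open>k\<close>, the total excess is at most
        one, so the excess at \<open>i0\<close> is too.\<close>
      then have "(\<Sum>i\<in>?I - {i0}. ?e k i) \<le> (\<Sum>i\<in>?I - {i0}. ?e m i)"
        by (intro sum_mono) (auto simp: not_less)
      then have "?e m i0 \<le> Suc (?e k i0)"
        using \<open>(\<Sum>i\<in>?I. ?e m i) \<le> _\<close> sum.remove[OF _ \<open>i0 \<in> ?I\<close>, of "?e m"]
          sum.remove[OF _ \<open>i0 \<in> ?I\<close>, of "?e k"] by simp
      with i0 \<open>i0 \<in> ?I\<close> show ?thesis by blast
    qed
    then show ?thesis using w by (intro prod_zero) fastforce+
  qed
  have "(\<Sum>x\<in>Pi\<^sub>E ?I A. (\<Prod>i\<in>?I. w i (x i)) * eval_mpoly f x) =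
      (\<Sum>m\<in>Poly_Mapping.keys f. ?e f m * (\<Prod>i\<in>?I. \<Sum>a\<in>A i. w i a * a ^ ?e m i))"
    using assms by (intro sum_weighted_eval_mpoly) auto
  also have "\<dots> = ?e f k * (\<Prod>i\<in>?I. \<Sum>a\<in>A i. w i a * a ^ ?e k i)"
    using k by (subst sum.remove[of _ k]) (simp_all add: off del: One_nat_def prod_zero_iff)
  also have "\<dots> = ?e f k"
    by (simp add: w)
  finally have "(\<Sum>x\<in>Pi\<^sub>E ?I A. (\<Prod>i\<in>?I. w i (x i)) * eval_mpoly f x) \<noteq> 0"
    using assms(5) by simp
  then obtain x where "x \<in> Pi\<^sub>E ?I A" "(\<Prod>i\<in>?I. w i (x i)) * eval_mpoly f x \<noteq> 0"
    by (rule sum.not_neutral_contains_not_neutral)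
  then show ?thesis by (intro bexI[of _ x]) auto
qed

end
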